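(* Let $q\geq 1$ and $n\geq 0$ be integers, let $\pi$ be a permutation of $\{1,\dots,n\}$, and let $\sigma=\Phi(\pi)$ be the image of $\pi$ under Foata's fundamental transformation $\Phi$. Then the number of adjacent $q$-cycles in the disjoint cycle decomposition of $\pi$ equals the number of occurrences of the mesh pattern $r_q$ in $\sigma$ plus the number of occurrences of the mesh pattern $s_q$ in $\sigma$.
   Context: Permutations act on $[n]=\{1,\dots,n\}$. An adjacent $q$-cycle of a permutation $\pi$ is a cycle of its disjoint cycle decomposition of the form $(i,i+1,\dots,i+q-1)$, i.e. $\pi(i)=i+1,\dots,\pi(i+q-2)=i+q-1$, $\pi(i+q-1)=i$ (for $q=1$ this is a fixed point, for $q=2$ an adjacent transposition). Foata's fundamental transformation $\Phi$: write each cycle of $\pi$ with its smallest element first, order the cycles so that their first elements are decreasing from left to right, erase the parentheses and read the resulting word as a permutation $\sigma$ in one-line notation. E.g. $213967548=(5,6,7)(4,9,8)(3)(1,2)\mapsto 567498312$. Mesh patterns: a mesh pattern is a pair $(\tau,R)$ where $\tau$ is a permutation of $[k]$ and $R\subseteq\{0,\dots,k\}\times\{0,\dots,k\}$ is a set of shaded boxes; box $(a,b)$ is the unit square $[a,a+1]\times[b,b+1]$ in the plot of the points $(i,\tau(i))$. An occurrence of $(\tau,R)$ in a permutation $\sigma$ of $[n]$ is a sequence of indices $i_1<\dots<i_k$ such that $\sigma(i_1)\cdots\sigma(i_k)$ is order-isomorphic to $\tau$ and, setting $i_0=0$, $i_{k+1}=n+1$, letting $v_1<\dots<v_k$ be the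 values $\sigma(i_1),\dots,\sigma(i_k)$ in increasing order, $v_0=0$, $v_{k+1}=n+1$, for every shaded box $(a,b)\in R$ there is no index $x$ with $i_a<x<i_{a+1}$ and $v_b<\sigma(x)<v_{b+1}$. The patterns: $r_q=(12\cdots q,\;R)$ with $R=\{0,\dots,q\}^2\setminus\{(0,q)\}$ (all boxes shaded except the top-left box). $s_q=(2\,3\cdots (q+1)\,1,\;S)$, a pattern of length $q+1$, with $S$ consisting of the boxes $(0,b)$ for $0\le b\le q$, all boxes $(a,b)$ with $1\le a\le q$ and $0\le b\le q+1$, and the boxes $(q+1,b)$ for $2\le b\le q$. (E.g. $s_1=(21,\{(0,0),(0,1),(1,0),(1,1),(1,2)\})$, $r_1=(1,\{(0,0),(1,0),(1,1)\})$.) *)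

theory Defs
  imports Main "HOL-Combinatorics.Cycles"
begin

text \<open>Permutations of \<open>[n]\<close> are functions \<open>\<pi>\<close> with \<open>\<pi> permutes {1..n}\<close>.\<close>

section \<open>Disjoint cycle decomposition and Foata's transformation\<close>

text \<open>
  \<open>support \<pi> m\<close> is the cycle \<open>[m, \<pi> m, \<pi> (\<pi> m), \<dots>]\<close> of \<open>\<pi>\<close> through \<open>m\<close>.
  Each cycle, fixed points included, is listed once, with its smallest element first,
  and the cycles are listed by increasing first element.
\<close>

definition perm_cycles :: "nat \<Rightarrow> (nat \<Rightarrow> nat) \<Rightarrow> nat list list" where
  "perm_cycles n \<pi> =
     map (support \<pi>) (filter (\<lambda>m. \<forall>x \<in> set (support \<pi> m). m \<le> x) [1..<n+1])"

text \<open>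
  A cycle in \<open>perm_cycles n \<pi>\<close> starts with its minimum, hence it is the cycle
  \<open>(i, i+1, \<dots>, i+q-1)\<close> iff it is literally the list \<open>[i..<i+q]\<close>.
\<close>

definition adjacent_cycles :: "nat \<Rightarrow> nat \<Rightarrow> (nat \<Rightarrow> nat) \<Rightarrow> nat list set" where
  "adjacent_cycles q n \<pi> = {c \<in> set (perm_cycles n \<pi>). \<exists>i. c = [i..<i+q]}"

definition foata_word :: "nat \<Rightarrow> (nat \<Rightarrow> nat) \<Rightarrow> nat list" where
  "foata_word n \<pi> = concat (rev (perm_cycles n \<pi>))"

definition foata :: "nat \<Rightarrow> (nat \<Rightarrow> nat) \<Rightarrow> nat \<Rightarrow> nat" where
  "foata n \<pi> i = (if i \<in> {1..n} then foata_word n \<pi> ! (i - 1) else i)"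

section \<open>Mesh patterns\<close>

text \<open>
  A mesh pattern consists of a permutation of \<open>{1..k}\<close> in one-line notation and a set of
  shaded boxes. List indexing starts at 0, so \<open>is ! a\<close> is the index written \<open>i\<^sub>a\<^sub>+\<^sub>1\<close>;
  prepending \<open>0\<close> in \<open>pos\<close> and \<open>val\<close> restores the usual numbering, that is,
  \<open>pos ! a\<close> is \<open>i\<^sub>a\<close> and \<open>val ! b\<close> is \<open>v\<^sub>b\<close>, including the sentinels \<open>0\<close> and \<open>n + 1\<close>.
\<close>

type_synonym mesh_pattern = "nat list \<times> (nat \<times> nat) set"

definition mesh_occurrence ::
  "mesh_pattern \<Rightarrow> nat \<Rightarrow> (nat \<Rightarrow> nat) \<Rightarrow> nat list \<Rightarrow> bool" where
  "mesh_occurrence P n \<sigma> is \<longleftrightarrow>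
     (let \<tau> = fst P; R = snd P;
          pos = 0 # is @ [n + 1];
          val = 0 # sort (map \<sigma> is) @ [n + 1]
      in length is = length \<tau> \<and> sorted_wrt (<) is \<and> set is \<subseteq> {1..n} \<and>
         (\<forall>a < length \<tau>. \<forall>b < length \<tau>. \<sigma> (is ! a) < \<sigma> (is ! b) \<longleftrightarrow> \<tau> ! a < \<tau> ! b) \<and>
         (\<forall>(a, b) \<in> R. \<not> (\<exists>x. pos ! a < x \<and> x < pos ! (a + 1) \<and>
                               val ! b < \<sigma> x \<and> \<sigma> x < val ! (b + 1))))"

definition mesh_occurrences :: "mesh_pattern \<Rightarrow> nat \<Rightarrow> (nat \<Rightarrow> nat) \<Rightarrow> nat list set" where
  "mesh_occurrences P n \<sigma> = {is. mesh_occurrence P n \<sigma> is}"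

definition pattern_r :: "nat \<Rightarrow> mesh_pattern" where
  "pattern_r q = ([1..<q+1], {0..q} \<times> {0..q} - {(0, q)})"

definition pattern_s :: "nat \<Rightarrow> mesh_pattern" where
  "pattern_s q = ([2..<q+2] @ [1],
     {0} \<times> {0..q} \<union> {1..q} \<times> {0..q+1} \<union> {q+1} \<times> {2..q})"

end

theory Submission
  imports Defs
begin

text \<open>
  The cycles of \<open>\<pi>\<close> begin exactly at the left-to-right minima of the word \<open>\<sigma>\<close>. Hence an adjacent
  \<open>q\<close>-cycle is a factor \<open>i (i+1) \<dots> (i+q-1)\<close> of \<open>\<sigma>\<close> that is preceded by larger letters only and is
  followed either by nothing or by a letter smaller than \<open>i\<close>. A factor at the end of the word has
  \<open>i = 1\<close> and is an occurrence of \<open>r\<^sub>q\<close>; any other one, together with the next letter, is an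
  occurrence of \<open>s\<^sub>q\<close>.
\<close>

section \<open>Concatenations of lists with decreasing minimal heads\<close>

text \<open>The shape in which Foata's transformation arranges the cycles. The heads of the blocks
  are exactly the left-to-right minima of the concatenation, so the blocks can be recovered from
  it.\<close>

definition min_headed :: "'a::linorder list list \<Rightarrow> bool" where
  "min_headed L \<longleftrightarrow>
     sorted_wrt (\<lambda>c d. hd d < hd c) L \<and> (\<forall>c \<in> set L. c \<noteq> [] \<and> (\<forall>x \<in> set c. hd c \<le> x))"

lemma min_headed_Cons:
  "min_headed (c # L) \<longleftrightarrow>
     c \<noteq> [] \<and> (\<forall>x \<in> set c. hd c \<le> x) \<and> (\<forall>d \<in> set L. hd d < hd c) \<and> min_headed L"
  by (auto simp: min_headed_def)

lemma min_headed_append: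
  "min_headed (L1 @ L2) \<longleftrightarrow>
     min_headed L1 \<and> min_headed L2 \<and> (\<forall>c \<in> set L1. \<forall>d \<in> set L2. hd d < hd c)"
  by (auto simp: min_headed_def sorted_wrt_append)

lemma hd_concat_min_headed:
  assumes "min_headed L" and "L \<noteq> []"
  shows "hd (concat L) = hd (hd L)"
  using assms by (cases L) (auto simp: min_headed_Cons)

text \<open>Larger letters before the factor make \<open>i\<close> a left-to-right minimum, hence
  the head of a block. A smaller letter after the factor opens the next block, and no letter of the
  factor falls below \<open>i\<close>, so the block ends exactly where the factor does.\<close>

lemma upt_mem_min_headed_iff:
  fixes i q :: nat
  assumes "q \<ge> 1" and "min_headed L"
  shows "[i..<i+q] \<in> set L \<longleftrightarrow>
    (\<exists>xs ys. concat L = xs @ [i..<i+q] @ ys \<and> (\<forall>x \<in> set xs. i < x) \<and> (ys = [] \<or> hd ys < i))"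
    (is "_ \<longleftrightarrow> ?run L")
proof
  assume "[i..<i+q] \<in> set L"
  then obtain L1 L2 where L: "L = L1 @ [i..<i+q] # L2"
    by (meson split_list)
  have hd_i: "hd [i..<i+q] = i"
    using assms(1) by simp
  have mh: "min_headed L1" "min_headed L2" "\<forall>d \<in> set L2. hd d < i" "\<forall>c \<in> set L1. i < hd c"
    using assms(2) hd_i unfolding L min_headed_append min_headed_Cons by auto
  \<comment> \<open>Each letter is at least the head of its block, and the earlier heads exceed
    \<open>i\<close>.\<close>
  have "i < x" if "x \<in> set (concat L1)" for x
    using that mh(1,4) unfolding min_headed_def by fastforce
  moreover have "concat L2 = [] \<or> hd (concat L2) < i"
    using hd_concat_min_headed[OF mh(2)] mh(3) by (cases L2) auto
  ultimately show "?run L"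
    unfolding L by (intro exI[of _ "concat L1"] exI[of _ "concat L2"]) auto
next
  have hd_i: "hd [i..<i+q] = i" and i_mem: "i \<in> set [i..<i+q]"
    using assms(1) by auto
  assume "?run L"
  then show "[i..<i+q] \<in> set L"
    using assms(2)
  proof (induction L)
    case Nil
    then show ?case using assms(1) by auto
  next
    case (Cons c L)
    then have c: "c \<noteq> []" "\<And>x. x \<in> set c \<Longrightarrow> hd c \<le> x" and L: "min_headed L"
      and lt: "\<And>d. d \<in> set L \<Longrightarrow> hd d < hd c"
      by (auto simp: min_headed_Cons)
    from Cons.prems(1) obtain xs ys where
      eq: "c @ concat L = xs @ [i..<i+q] @ ys" and xs: "\<forall>x \<in> set xs. i < x"
      and ys: "ys = [] \<or> hd ys < i"
      by auto
    show ?case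
    proof (cases "xs = []")
      case True
      with eq c(1) hd_i i_mem have hd_c: "hd c = i"
        by (metis append_Nil empty_iff hd_append2 list.set(1))
      \<comment> \<open>Block and factor start together, so one is a prefix of the other. A rest of
        \<open>c\<close> would begin with a letter below the minimum \<open>i\<close> of
        \<open>c\<close>; a rest of the factor would begin with the head of the next block, again
        below \<open>i\<close>.\<close>
      from eq True consider
        (longer) us where "c = [i..<i+q] @ us" "us @ concat L = ys"
        | (shorter) us where "[i..<i+q] = c @ us" "us @ ys = concat L"
        by (auto simp: append_eq_append_conv2)
      then have "c = [i..<i+q]"
      proof cases
        case longer
        have "us = []"
        proof (rule ccontr)
          assume "us \<noteq> []"
          then have "hd us \<in> set c" "hd us < i"
            using longer ys by auto
          then show False
            using c(2) hd_c by force
        qed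
        with longer show ?thesis by simp
      next
        case shorter
        have "us = []"
        proof (rule ccontr)
          assume us: "us \<noteq> []"
          then have "L \<noteq> []"
            using shorter by auto
          then have "hd us < i"
            using hd_concat_min_headed[OF L] lt hd_c us shorter(2) by (metis hd_append2 hd_in_set)
          moreover have "hd us \<in> set [i..<i+q]"
            using us shorter(1) by simp
          ultimately show False by simp
        qed
        with shorter show ?thesis by simp
      qed
      then show ?thesis by simp
    next
      case False
      \<comment> \<open>The factor starts inside \<open>c\<close> or later. Requiring
        \<open>us \<noteq> []\<close> sends the boundary case \<open>c = xs\<close> to
        \<open>after\<close>, with \<open>us = []\<close>.\<close>
      from eq consider
        (inside) us where "c = xs @ us" "us \<noteq> []" "us @ concat L = [i..<i+q] @ ys"
        | (after) us where "xs = c @ us" "concat L = us @ [i..<i+q] @ ys"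
        by (fastforce simp: append_eq_append_conv2)
      then show ?thesis
      proof cases
        case inside
        then have "hd us = i"
          using hd_i i_mem by (metis empty_iff hd_append2 list.set(1))
        then have "i \<in> set c"
          using inside by auto
        \<comment> \<open>Since \<open>xs\<close> is nonempty, it contains the first letter of
          \<open>c\<close>; but that letter is the minimum of \<open>c\<close>, which contains
          \<open>i\<close>.\<close>
        moreover have "i < hd c"
          using xs False inside(1) by auto
        ultimately show ?thesis
          using c(2) by force
      next
        case after
        then have "[i..<i+q] \<in> set L"
          using xs ys by (intro Cons.IH[OF _ L] exI[of _ us] exI[of _ ys]) auto
        then show ?thesis by simp
      qed
    qed
  qed
qed

section \<open>The word of Foata's transformation\<close>

text \<open>\<open>least_power p a\<close> is positive, so the exponent 0 occurs in the
  list.\<close>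

lemma mem_own_support: "permutation p \<Longrightarrow> a \<in> set (support p a)"
  using least_power_of_permutation(2)[of p a] by force

lemma hd_support: "permutation p \<Longrightarrow> hd (support p a) = a"
  using least_power_of_permutation(2)[of p a] by (simp add: hd_map)

lemma set_support_subset:
  assumes "p permutes S" and "a \<in> S"
  shows "set (support p a) \<subseteq> S"
  using permutes_in_image[OF permutes_funpow[OF assms(1)]] assms(2) by auto

text \<open>The filter keeps the starts that are minimal in their cycles, and \<open>rev\<close>
  turns their increasing order into a decreasing one.\<close>

lemma min_headed_perm_cycles:
  assumes "permutation \<pi>"
  shows "min_headed (rev (perm_cycles n \<pi>))"
proof -
  have "sorted_wrt (<) (filter P [1..<n+1])" for P
    by (rule sorted_wrt_filter) (simp del: upt_Suc)
  then have "sorted_wrt (\<lambda>a b. hd (support \<pi> a) < hd (support \<pi> b)) (filter P [1..<n+1])" for P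
    unfolding hd_support[OF assms] .
  then show ?thesis
    unfolding min_headed_def perm_cycles_def sorted_wrt_rev sorted_wrt_map
    using hd_support[OF assms] mem_own_support[OF assms] by fastforce
qed

text \<open>Cycles are equal or disjoint as sets. Two kept starts in a common cycle are both its
  minimum, so nothing is listed twice; and each point occurs in the list that starts at the minimum
  of its cycle.\<close>

lemma foata_word_permutation:
  assumes "\<pi> permutes {1..n}"
  shows "distinct (foata_word n \<pi>)" and "set (foata_word n \<pi>) = {1..n}"
proof -
  have perm: "permutation \<pi>"
    using assms permutation_permutes by blast
  let ?M = "filter (\<lambda>m. \<forall>x \<in> set (support \<pi> m). m \<le> x) [1..<n+1]"
  have same: "a = b" if "a \<in> set ?M" "b \<in> set ?M"
    "set (support \<pi> a) \<inter> set (support \<pi> b) \<noteq> {}" for a b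
  proof -
    have "a \<in> set (support \<pi> b)" "b \<in> set (support \<pi> a)"
      using that(3) disjoint_support'[OF perm] by blast+
    then have "a \<le> b" "b \<le> a"
      using that(1,2) unfolding set_filter by blast+
    then show ?thesis by simp
  qed
  have inj: "inj_on (support \<pi>) (set ?M)"
    by (rule inj_onI) (metis hd_support[OF perm])
  have cycle: "distinct (support \<pi> a)" for a
    using cycle_of_permutation[OF perm] by simp
  show "distinct (foata_word n \<pi>)"
    unfolding foata_word_def
  proof (rule distinct_concat)
    show "distinct (rev (perm_cycles n \<pi>))"
      unfolding perm_cycles_def using inj by (simp add: distinct_map)
  next
    fix c assume "c \<in> set (rev (perm_cycles n \<pi>))"
    then show "distinct c"
      unfolding perm_cycles_def using cycle by auto
  next
    fix c d assume "c \<in> set (rev (perm_cycles n \<pi>))" "d \<in> set (rev (perm_cycles n \<pi>))" "c \<noteq> d"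
    then obtain a b where "a \<in> set ?M" "b \<in> set ?M" "c = support \<pi> a" "d = support \<pi> b" "a \<noteq> b"
      unfolding perm_cycles_def set_rev set_map by blast
    then show "set c \<inter> set d = {}"
      using same by blast
  qed
  show "set (foata_word n \<pi>) = {1..n}"
  proof
    show "set (foata_word n \<pi>) \<subseteq> {1..n}"
      using set_support_subset[OF assms] unfolding foata_word_def perm_cycles_def by fastforce
  next
    show "{1..n} \<subseteq> set (foata_word n \<pi>)"
    proof
      fix x assume x: "x \<in> {1..n}"
      let ?C = "set (support \<pi> x)"
      define m where "m = Min ?C"
      have m: "m \<in> ?C"
        unfolding m_def using mem_own_support[OF perm, of x] by (intro Min_in) auto
      then have "set (support \<pi> m) \<inter> ?C \<noteq> {}"
        using mem_own_support[OF perm, of m] by blast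
      then have eq: "set (support \<pi> m) = ?C"
        using disjointD[OF disjoint_support[OF perm], of "set (support \<pi> m)" ?C] by blast
      then have "\<forall>y \<in> set (support \<pi> m). m \<le> y"
        unfolding m_def by simp
      moreover have "m \<in> {1..n}"
        using m set_support_subset[OF assms x] by blast
      ultimately have "support \<pi> m \<in> set (perm_cycles n \<pi>)"
        unfolding perm_cycles_def set_map set_filter by (intro imageI) auto
      moreover have "x \<in> set (support \<pi> m)"
        unfolding eq by (rule mem_own_support[OF perm])
      ultimately show "x \<in> set (foata_word n \<pi>)"
        unfolding foata_word_def set_concat set_rev by (rule UN_I)
    qed
  qed
qed

lemma length_foata_word:
  assumes "\<pi> permutes {1..n}"
  shows "length (foata_word n \<pi>) = n"
  using distinct_card[OF foata_word_permutation(1)[OF assms]] foata_word_permutation(2)[OF assms]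
  by simp

lemma foata_nth:
  assumes "x < n"
  shows "foata n \<pi> (Suc x) = foata_word n \<pi> ! x"
  using assms by (simp add: foata_def)

lemma bij_betw_foata:
  assumes "\<pi> permutes {1..n}"
  shows "bij_betw (foata n \<pi>) {1..n} {1..n}"
proof -
  have "bij_betw (\<lambda>x. x - 1) {1..n} {..<n}"
    by (rule bij_betwI[of _ _ _ Suc]) auto
  moreover have "bij_betw ((!) (foata_word n \<pi>)) {..<n} {1..n}"
    using bij_betw_nth[OF foata_word_permutation(1)[OF assms]]
      foata_word_permutation(2)[OF assms] length_foata_word[OF assms] by simp
  ultimately have "bij_betw ((!) (foata_word n \<pi>) \<circ> (\<lambda>x. x - 1)) {1..n} {1..n}"
    by (rule bij_betw_trans)
  then show ?thesis
    by (rule bij_betw_cong[THEN iffD1, rotated]) (simp add: foata_def)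
qed

section \<open>Adjacent cycles as runs of the word\<close>

text \<open>The run occupies the positions \<open>p+1, \<dots>, p+q\<close>, so \<open>p = 0\<close> is allowed.\<close>

definition run_before :: "nat \<Rightarrow> nat \<Rightarrow> (nat \<Rightarrow> nat) \<Rightarrow> nat \<Rightarrow> bool" where
  "run_before q n \<sigma> p \<longleftrightarrow>
     p + q \<le> n \<and> (\<forall>j < q. \<sigma> (p + 1 + j) = \<sigma> (p + 1) + j) \<and>
     (\<forall>x \<in> {1..p}. \<sigma> (p + 1) < \<sigma> x) \<and> (p + q < n \<longrightarrow> \<sigma> (p + q + 1) < \<sigma> (p + 1))"

text \<open>Translates the factorisation \<open>xs @ [i..<i+q] @ ys\<close> of the word into
  positions, with \<open>p\<close> the length of \<open>xs\<close>. From here on only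
  \<open>\<sigma>\<close> matters.\<close>

lemma adjacent_cycles_eq_runs:
  assumes q: "q \<ge> 1" and \<pi>: "\<pi> permutes {1..n}" and \<sigma>: "\<sigma> = foata n \<pi>"
  shows "adjacent_cycles q n \<pi> =
    (\<lambda>p. [\<sigma> (p + 1)..<\<sigma> (p + 1) + q]) ` {p. run_before q n \<sigma> p}"
proof -
  have perm: "permutation \<pi>"
    using \<pi> permutation_permutes by blast
  let ?w = "foata_word n \<pi>"
  note len = length_foata_word[OF \<pi>]
  have nth: "\<sigma> (Suc x) = ?w ! x" if "x < n" for x
    unfolding \<sigma> by (rule foata_nth[OF that])
  have mem_iff: "[i..<i+q] \<in> set (perm_cycles n \<pi>) \<longleftrightarrow>
    (\<exists>xs ys. ?w = xs @ [i..<i+q] @ ys \<and> (\<forall>x \<in> set xs. i < x) \<and> (ys = [] \<or> hd ys < i))" for i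
    using upt_mem_min_headed_iff[OF q min_headed_perm_cycles[OF perm, of n], of i]
    by (simp add: foata_word_def)
  have mem: "[i..<i+q] \<in> set (perm_cycles n \<pi>) \<longleftrightarrow> (\<exists>p. run_before q n \<sigma> p \<and> \<sigma> (p + 1) = i)" for i
  proof
    assume "[i..<i+q] \<in> set (perm_cycles n \<pi>)"
    then obtain xs ys where w: "?w = xs @ [i..<i+q] @ ys" and xs: "\<forall>x \<in> set xs. i < x"
      and ys: "ys = [] \<or> hd ys < i"
      using mem_iff by blast
    let ?p = "length xs"
    have n: "n = ?p + q + length ys"
      using w len by (metis add.assoc add_diff_cancel_left' length_append length_upt)
    have run: "\<sigma> (Suc (?p + j)) = i + j" if "j < q" for j
    proof -
      have "?w ! (?p + j) = i + j"
        using that by (simp add: w nth_append)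
      then show ?thesis
        using nth[of "?p + j"] that n by simp
    qed
    have before: "i < \<sigma> x" if x: "x \<in> {1..?p}" for x
    proof -
      have "\<sigma> x = xs ! (x - 1)"
      proof -
        have "?w ! (x - 1) = xs ! (x - 1)"
          using x by (auto simp: w nth_append)
        then show ?thesis
          using nth[of "x - 1"] x n by auto
      qed
      moreover have "xs ! (x - 1) \<in> set xs"
        using x by (intro nth_mem) auto
      ultimately show ?thesis
        using xs by simp
    qed
    \<comment> \<open>\<open>p + q < n\<close> says that \<open>ys\<close> is nonempty; position
      \<open>p + q + 1\<close> then holds its head.\<close>
    have after: "\<sigma> (Suc (?p + q)) < i" if "?p + q < n"
    proof -
      have "ys \<noteq> []" using that n by auto
      moreover have "\<sigma> (Suc (?p + q)) = ys ! 0"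
        using nth[OF that] by (simp add: w nth_append)
      ultimately show ?thesis
        using ys by (simp add: hd_conv_nth)
    qed
    have "\<sigma> (Suc ?p) = i"
      using run[of 0] q by simp
    then show "\<exists>p. run_before q n \<sigma> p \<and> \<sigma> (p + 1) = i"
      using run before after n by (intro exI[of _ ?p]) (simp add: run_before_def)
  next
    assume "\<exists>p. run_before q n \<sigma> p \<and> \<sigma> (p + 1) = i"
    then obtain p where run: "run_before q n \<sigma> p" and i: "\<sigma> (p + 1) = i"
      by blast
    have pq: "p + q \<le> n" using run by (simp add: run_before_def)
    let ?xs = "take p ?w" and ?ys = "drop (p + q) ?w"
    have "take q (drop p ?w) = [i..<i+q]"
      using run i pq len nth by (intro nth_equalityI) (auto simp: run_before_def)
    then have "?w = ?xs @ [i..<i+q] @ ?ys"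
      by (metis add.commute append_take_drop_id drop_drop)
    moreover have "i < x" if x: "x \<in> set ?xs" for x
    proof -
      obtain k where "k < p" "x = ?w ! k"
        using x len pq by (auto simp: in_set_conv_nth)
      moreover have "i < \<sigma> (Suc k)"
        using run i \<open>k < p\<close> unfolding run_before_def by auto
      ultimately show ?thesis
        using nth[of k] pq q by simp
    qed
    moreover have "?ys = [] \<or> hd ?ys < i"
    proof (cases "p + q < n")
      case True
      then show ?thesis
        using run i nth[OF True] len by (simp add: run_before_def hd_drop_conv_nth)
    qed (simp add: len)
    ultimately show "[i..<i+q] \<in> set (perm_cycles n \<pi>)"
      using mem_iff by blast
  qed
  show ?thesis
  proof (intro equalityI subsetI)
    fix c assume "c \<in> adjacent_cycles q n \<pi>"
    then obtain i where "c = [i..<i+q]" "[i..<i+q] \<in> set (perm_cycles n \<pi>)"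
      unfolding adjacent_cycles_def by blast
    then show "c \<in> (\<lambda>p. [\<sigma> (p + 1)..<\<sigma> (p + 1) + q]) ` {p. run_before q n \<sigma> p}"
      using mem[of i] by blast
  next
    fix c assume "c \<in> (\<lambda>p. [\<sigma> (p + 1)..<\<sigma> (p + 1) + q]) ` {p. run_before q n \<sigma> p}"
    then obtain p where "c = [\<sigma> (p + 1)..<\<sigma> (p + 1) + q]" "run_before q n \<sigma> p"
      by blast
    then show "c \<in> adjacent_cycles q n \<pi>"
      unfolding adjacent_cycles_def using mem[of "\<sigma> (p + 1)"] by blast
  qed
qed

section \<open>Consecutive rows and columns of mesh patterns\<close>

text \<open>A discrete intermediate value argument: on the way from an entry below \<open>y\<close>
  to one above it, some step crosses \<open>y\<close>. It finds the row or column of the grid in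
  which a point lies.\<close>

lemma nth_between:
  fixes y :: "'a::linorder"
  assumes "vs \<noteq> []" and "y \<notin> set vs" and "hd vs < y" and "y < last vs"
  shows "\<exists>b. Suc b < length vs \<and> vs ! b < y \<and> y < vs ! Suc b"
  using assms
proof (induction vs)
  case (Cons v vs)
  show ?case
  proof (cases "vs \<noteq> [] \<and> hd vs < y")
    case True
    then obtain b where "Suc b < length vs \<and> vs ! b < y \<and> y < vs ! Suc b"
      using Cons by auto
    then show ?thesis by (intro exI[of _ "Suc b"]) auto
  next
    case False
    then have "vs \<noteq> []" "y < vs ! 0"
      using Cons.prems by (auto simp: hd_conv_nth split: if_splits) (metis linorder_neqE nth_mem length_greater_0_conv)
    then show ?thesis
      using Cons.prems by (intro exI[of _ 0]) auto
  qed
qed simp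

text \<open>An entry \<open>vs ! k\<close> equal to \<open>y\<close> would need
  \<open>b < k < Suc b\<close>.\<close>

lemma not_mem_between:
  fixes y :: "'a::linorder"
  assumes "sorted_wrt (<) vs" and "Suc b < length vs" and "vs ! b < y" and "y < vs ! Suc b"
  shows "y \<notin> set vs"
proof
  assume "y \<in> set vs"
  then obtain k where k: "k < length vs" "y = vs ! k"
    by (auto simp: in_set_conv_nth)
  have "b < k"
    using sorted_wrt_nth_less[OF assms(1), of k b] assms k by (metis linorder_neqE_nat not_less_iff_gr_or_eq Suc_lessD)
  moreover have "k < Suc b"
    using sorted_wrt_nth_less[OF assms(1), of "Suc b" k] assms k by (metis linorder_neqE_nat not_less_iff_gr_or_eq)
  ultimately show False by simp
qed

text \<open>The vertical grid lines with the borders 0 and \<open>n + 1\<close>; column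
  \<open>a\<close> lies between entries \<open>a\<close> and \<open>Suc a\<close>. The horizontal
  lines below are numbered likewise.\<close>

abbreviation mesh_positions :: "nat \<Rightarrow> nat list \<Rightarrow> nat list" where
  "mesh_positions n is \<equiv> 0 # is @ [n + 1]"

abbreviation mesh_values :: "nat \<Rightarrow> (nat \<Rightarrow> nat) \<Rightarrow> nat list \<Rightarrow> nat list" where
  "mesh_values n \<sigma> is \<equiv> 0 # sort (map \<sigma> is) @ [n + 1]"

lemma mesh_occurrence_iff:
  "mesh_occurrence (\<tau>, R) n \<sigma> is \<longleftrightarrow>
     length is = length \<tau> \<and> sorted_wrt (<) is \<and> set is \<subseteq> {1..n} \<and>
     (\<forall>a < length \<tau>. \<forall>b < length \<tau>. \<sigma> (is ! a) < \<sigma> (is ! b) \<longleftrightarrow> \<tau> ! a < \<tau> ! b) \<and>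
     (\<forall>a b x. (a, b) \<in> R \<longrightarrow> mesh_positions n is ! a < x \<longrightarrow> x < mesh_positions n is ! Suc a \<longrightarrow>
        mesh_values n \<sigma> is ! b < \<sigma> x \<longrightarrow> \<sigma> x < mesh_values n \<sigma> is ! Suc b \<longrightarrow> False)"
  unfolding mesh_occurrence_def Let_def by (auto simp del: nth_Cons_Suc)

lemma sorted_mesh_positions:
  assumes "sorted_wrt (<) is" and "set is \<subseteq> {1..n}"
  shows "sorted_wrt (<) (mesh_positions n is)"
  using assms by (fastforce simp: sorted_wrt_append)

lemma sorted_mesh_values:
  assumes "bij_betw \<sigma> {1..n} {1..n}" and "sorted_wrt (<) is" and "set is \<subseteq> {1..n}"
  shows "sorted_wrt (<) (mesh_values n \<sigma> is)"
proof -
  have "inj_on \<sigma> (set is)"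
    using assms(1,3) bij_betw_imp_inj_on inj_on_subset by blast
  moreover have "distinct is"
    using assms(2) strict_sorted_iff by blast
  ultimately have "sorted_wrt (<) (sort (map \<sigma> is))"
    by (simp add: strict_sorted_iff distinct_map)
  moreover have "\<sigma> ` set is \<subseteq> {1..n}"
    using assms(1,3) bij_betw_imp_surj_on by blast
  ultimately show ?thesis
    by (fastforce simp: sorted_wrt_append)
qed

lemma set_mesh_values: "set (mesh_values n \<sigma> is) = insert 0 (insert (n + 1) (\<sigma> ` set is))"
  by auto

lemma mesh_nth_le_last:
  fixes vs :: "nat list"
  assumes "sorted_wrt (<) (0 # vs @ [n + 1])" and "k < length vs + 2"
  shows "(0 # vs @ [n + 1]) ! k \<le> n + 1"
proof -
  have "(0 # vs @ [n + 1]) ! k \<in> set (0 # vs @ [n + 1])"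
    using assms(2) by (intro nth_mem) simp
  then show ?thesis
    using assms(1) by (auto simp: sorted_wrt_append)
qed

text \<open>If the two bounding lines were not adjacent, the position right after the first would
  carry a point inside the column. That point lies in some row, and every box of the column is
  shaded.\<close>

lemma shaded_column_consecutive:
  assumes bij: "bij_betw \<sigma> {1..n} {1..n}" and occ: "mesh_occurrence (\<tau>, R) n \<sigma> is"
    and a: "a \<le> length \<tau>" and shaded: "{a} \<times> {0..length \<tau>} \<subseteq> R"
  shows "mesh_positions n is ! Suc a = Suc (mesh_positions n is ! a)"
proof (rule ccontr)
  let ?P = "mesh_positions n is" and ?V = "mesh_values n \<sigma> is"
  assume neq: "?P ! Suc a \<noteq> Suc (?P ! a)"
  have len: "length is = length \<tau>" and srt: "sorted_wrt (<) is" and sub: "set is \<subseteq> {1..n}"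
    using occ unfolding mesh_occurrence_iff by blast+
  note sP = sorted_mesh_positions[OF srt sub]
  have bound: "Suc a < length ?P"
    using a len by simp
  define x where "x = Suc (?P ! a)"
  have "?P ! a < ?P ! Suc a"
    using sorted_wrt_nth_less[OF sP _ bound] by simp
  then have x: "?P ! a < x" "x < ?P ! Suc a"
    using neq unfolding x_def by auto
  then have x_notin: "x \<notin> set is"
    using not_mem_between[OF sP bound] by auto
  have xn: "x \<in> {1..n}"
    using x(2) mesh_nth_le_last[OF sP, of "Suc a"] bound unfolding x_def by auto
  then have yn: "\<sigma> x \<in> {1..n}"
    using bij bij_betwE by blast
  \<comment> \<open>By injectivity the point is on no horizontal line, so it falls strictly inside a
    row.\<close>
  moreover have "\<sigma> x \<notin> \<sigma> ` set is"
    using bij x_notin xn sub by (auto simp: bij_betw_def dest!: inj_onD)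
  ultimately have "\<sigma> x \<notin> set ?V"
    unfolding set_mesh_values by auto
  then obtain b where b: "Suc b < length ?V" "?V ! b < \<sigma> x" "\<sigma> x < ?V ! Suc b"
    using nth_between[of ?V "\<sigma> x"] yn by auto
  then have "(a, b) \<in> R"
    using shaded len by auto
  then show False
    using occ x b unfolding mesh_occurrence_iff by blast
qed

text \<open>The column argument with the axes exchanged: surjectivity supplies the position of the
  value right above line \<open>b\<close>.\<close>

lemma shaded_row_consecutive:
  assumes bij: "bij_betw \<sigma> {1..n} {1..n}" and occ: "mesh_occurrence (\<tau>, R) n \<sigma> is"
    and b: "b \<le> length \<tau>" and shaded: "{0..length \<tau>} \<times> {b} \<subseteq> R"
  shows "mesh_values n \<sigma> is ! Suc b = Suc (mesh_values n \<sigma> is ! b)"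
proof (rule ccontr)
  let ?P = "mesh_positions n is" and ?V = "mesh_values n \<sigma> is"
  assume neq: "?V ! Suc b \<noteq> Suc (?V ! b)"
  have len: "length is = length \<tau>" and srt: "sorted_wrt (<) is" and sub: "set is \<subseteq> {1..n}"
    using occ unfolding mesh_occurrence_iff by blast+
  note sV = sorted_mesh_values[OF bij srt sub]
  have bound: "Suc b < length ?V"
    using b len by simp
  define y where "y = Suc (?V ! b)"
  have "?V ! b < ?V ! Suc b"
    using sorted_wrt_nth_less[OF sV _ bound] by simp
  then have y: "?V ! b < y" "y < ?V ! Suc b"
    using neq unfolding y_def by auto
  then have y_notin: "y \<notin> set ?V"
    using not_mem_between[OF sV bound] by blast
  have "y \<in> {1..n}"
    using y(2) mesh_nth_le_last[OF sV, of "Suc b"] bound unfolding y_def by auto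
  then obtain x where x: "x \<in> {1..n}" "y = \<sigma> x"
    using bij by (metis bij_betw_imp_surj_on imageE)
  then have "x \<notin> set ?P"
    using y_notin unfolding set_mesh_values by auto
  then obtain a where a: "Suc a < length ?P" "?P ! a < x" "x < ?P ! Suc a"
    using nth_between[of ?P x] x by auto
  then have "(a, b) \<in> R"
    using shaded len by auto
  then show False
    using occ y a unfolding x(2) mesh_occurrence_iff by blast
qed

lemma nth_add_of_consecutive:
  fixes vs :: "nat list"
  assumes "\<And>k. a \<le> k \<Longrightarrow> k < a + m \<Longrightarrow> vs ! Suc k = Suc (vs ! k)" and "j \<le> m"
  shows "vs ! (a + j) = vs ! a + j"
  using assms(2)
proof (induction j)
  case (Suc j)
  then show ?case using assms(1)[of "a + j"] by simp
qed simp

section \<open>Occurrences of the two patterns\<close>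

lemma nth_upt_Cons_append:
  assumes "1 \<le> a" and "a \<le> q + 1"
  shows "(0 # [p+1..<p+q+1] @ [p+q+1]) ! a = p + a"
  using assms by (cases a) (auto simp: nth_append le_Suc_eq simp del: upt_Suc)

text \<open>Columns 1 to \<open>q\<close> are fully shaded, so the positions are consecutive and end
  at \<open>n\<close>. Rows 0 to \<open>q - 1\<close> are fully shaded, so the values are 1 to
  \<open>q\<close>. Conversely, a run ending the word must start with the value 1.\<close>

lemma mesh_occurrences_r:
  assumes bij: "bij_betw \<sigma> {1..n} {1..n}" and q: "q \<ge> 1"
  shows "mesh_occurrences (pattern_r q) n \<sigma> =
    (\<lambda>p. [p+1..<p+q+1]) ` {p. run_before q n \<sigma> p \<and> p + q = n}"
proof (intro equalityI subsetI)
  fix "is" assume "is \<in> mesh_occurrences (pattern_r q) n \<sigma>"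
  then have occ: "mesh_occurrence ([1..<q+1], {0..q} \<times> {0..q} - {(0, q)}) n \<sigma> is"
    by (simp add: mesh_occurrences_def pattern_r_def)
  let ?P = "mesh_positions n is" and ?V = "mesh_values n \<sigma> is"
  have len: "length is = q" and srt: "sorted_wrt (<) is" and sub: "set is \<subseteq> {1..n}"
    and ord: "\<And>a b. a < q \<Longrightarrow> b < q \<Longrightarrow> \<sigma> (is ! a) < \<sigma> (is ! b) \<longleftrightarrow> a < b"
    using occ unfolding mesh_occurrence_iff by (auto simp del: upt_Suc)
  have P: "?P ! (1 + j) = ?P ! 1 + j" if "j \<le> q" for j
    using that by (intro nth_add_of_consecutive[of _ q] shaded_column_consecutive[OF bij occ]) auto
  have V: "?V ! (0 + j) = ?V ! 0 + j" if "j \<le> q" for j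
    using that by (intro nth_add_of_consecutive[of _ q] shaded_row_consecutive[OF bij occ]) auto
  define p where "p = is ! 0 - 1"
  have "is ! 0 \<in> {1..n}"
    using sub len q by (metis nth_mem subsetD less_le_trans zero_less_one)
  then have is0: "is ! 0 = p + 1"
    unfolding p_def by auto
  have isj: "is ! j = p + 1 + j" if "j < q" for j
    using P[of j] that is0 len q by (simp add: nth_append)
  \<comment> \<open>Entry \<open>q + 1\<close> of the positions is the border
    \<open>n + 1\<close>.\<close>
  have pq: "p + q = n"
    using P[of q] is0 len q by (simp add: nth_append)
  have is_eq: "is = [p+1..<p+q+1]"
    using len isj by (intro nth_equalityI) (auto simp del: upt_Suc)
  have "sorted (map \<sigma> is)"
    using ord len by (auto simp: sorted_wrt_iff_nth_less intro!: less_imp_le)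
  then have "sort (map \<sigma> is) = map \<sigma> is"
    by (rule sorted_sort_id)
  then have val: "\<sigma> (p + 1 + j) = 1 + j" if "j < q" for j
    using V[of "Suc j"] that isj[OF that] len by (simp add: nth_append)
  have "1 < \<sigma> x" if x: "x \<in> {1..p}" for x
  proof -
    have "\<sigma> x \<noteq> \<sigma> (p + 1)"
      using bij x pq q by (auto simp: bij_betw_def dest!: inj_onD)
    moreover have "\<sigma> x \<in> {1..n}"
      using bij x pq by (auto dest!: bij_betwE)
    ultimately show ?thesis
      using val[of 0] q by auto
  qed
  then have "run_before q n \<sigma> p"
    using val val[of 0] q pq unfolding run_before_def by auto
  then show "is \<in> (\<lambda>p. [p+1..<p+q+1]) ` {p. run_before q n \<sigma> p \<and> p + q = n}"
    using is_eq pq by blast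
next
  fix "is" assume "is \<in> (\<lambda>p. [p+1..<p+q+1]) ` {p. run_before q n \<sigma> p \<and> p + q = n}"
  then obtain p where is_eq: "is = [p+1..<p+q+1]" and run: "run_before q n \<sigma> p" and n: "n = p + q"
    by blast
  \<comment> \<open>Every position lies before the run, where letters are larger, or in the run,
    where they only grow.\<close>
  have min: "\<sigma> (p + 1) \<le> \<sigma> x" if "x \<in> {1..n}" for x
  proof (cases "x \<le> p")
    case True
    then have "\<sigma> (p + 1) < \<sigma> x"
      using run that unfolding run_before_def by auto
    then show ?thesis by simp
  next
    case False
    then obtain j where "x = p + 1 + j"
      using nat_le_iff_add[of "p + 1" x] by auto
    then show ?thesis
      using run that n unfolding run_before_def by auto
  qed
  obtain x where "x \<in> {1..n}" "\<sigma> x = 1"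
    using bij q n by (metis atLeastAtMost_iff bij_betw_imp_surj_on imageE le_add2 le_trans order_refl)
  moreover have "\<sigma> (p + 1) \<in> {1..n}"
    using bij q n by (auto dest!: bij_betwE)
  ultimately have "\<sigma> (p + 1) = 1"
    using min by fastforce
  then have val: "\<sigma> (p + 1 + j) = 1 + j" if "j < q" for j
    using run that by (simp add: run_before_def)
  have "map \<sigma> is = [1..<q+1]"
    using val by (intro nth_equalityI) (auto simp: is_eq simp del: upt_Suc)
  then have V: "mesh_values n \<sigma> is = 0 # [1..<q+1] @ [n + 1]"
    by (simp add: sorted_sort_id del: upt_Suc)
  have nthV: "mesh_values n \<sigma> is ! b = b" if "b \<le> q" for b
    using that unfolding V by (cases b) (auto simp: nth_append simp del: upt_Suc)
  have nthP: "mesh_positions n is ! a = p + a" if "1 \<le> a" "a \<le> q + 1" for a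
    using nth_upt_Cons_append[OF that] unfolding is_eq n .
  have "mesh_occurrence ([1..<q+1], {0..q} \<times> {0..q} - {(0, q)}) n \<sigma> is"
    unfolding mesh_occurrence_iff
  proof (intro conjI allI impI)
    fix a b x
    assume ab: "(a, b) \<in> {0..q} \<times> {0..q} - {(0, q)}"
      and x: "mesh_positions n is ! a < x" "x < mesh_positions n is ! Suc a"
      and y: "mesh_values n \<sigma> is ! b < \<sigma> x" "\<sigma> x < mesh_values n \<sigma> is ! Suc b"
    \<comment> \<open>Column 0 leaves only rows \<open>b < q\<close>, which lie between the values
      \<open>b\<close> and \<open>b + 1\<close>; any other column lies between adjacent positions.
      Neither has interior points.\<close>
    show False
    proof (cases "a = 0")
      case True
      then show ?thesis using ab y nthV[of b] nthV[of "Suc b"] by auto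
    next
      case False
      then show ?thesis using ab x nthP[of a] nthP[of "Suc a"] by auto
    qed
  qed (use n val in \<open>auto simp: is_eq simp del: upt_Suc\<close>)
  then show "is \<in> mesh_occurrences (pattern_r q) n \<sigma>"
    by (simp add: mesh_occurrences_def pattern_r_def)
qed

text \<open>In an occurrence of the second pattern the last letter is the smallest, so sorting only
  moves it to the front.\<close>

lemma sort_snoc_min:
  assumes "sorted (c # ws)"
  shows "sort (ws @ [c]) = c # ws"
  using assms by (intro properties_for_sort) auto

text \<open>Full columns 1 to \<open>q\<close> make the positions consecutive, and full rows 2 to
  \<open>q\<close> make the first \<open>q\<close> letters a run. The shading of column 0 puts all
  earlier letters above the run. The last letter of the pattern is the smaller letter that
  follows.\<close>

lemma mesh_occurrences_s:
  assumes bij: "bij_betw \<sigma> {1..n} {1..n}" and q: "q \<ge> 1"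
  shows "mesh_occurrences (pattern_s q) n \<sigma> =
    (\<lambda>p. [p+1..<p+q+2]) ` {p. run_before q n \<sigma> p \<and> p + q < n}"
proof (intro equalityI subsetI)
  let ?R = "{0} \<times> {0..q} \<union> {1..q} \<times> {0..q+1} \<union> {q+1} \<times> {2..q}"
  fix "is" assume "is \<in> mesh_occurrences (pattern_s q) n \<sigma>"
  then have occ: "mesh_occurrence ([2..<q+2] @ [1], ?R) n \<sigma> is"
    by (simp add: mesh_occurrences_def pattern_s_def del: upt_Suc)
  let ?P = "mesh_positions n is" and ?V = "mesh_values n \<sigma> is"
  have len: "length is = q + 1" and srt: "sorted_wrt (<) is" and sub: "set is \<subseteq> {1..n}"
    and ord: "\<And>a b. a < q + 1 \<Longrightarrow> b < q + 1 \<Longrightarrow>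
      \<sigma> (is ! a) < \<sigma> (is ! b) \<longleftrightarrow> ([2..<q+2] @ [1]) ! a < ([2..<q+2] @ [1]) ! b"
    using occ unfolding mesh_occurrence_iff by (auto simp del: upt_Suc)
  have P: "?P ! (1 + j) = ?P ! 1 + j" if "j \<le> q" for j
    using that by (intro nth_add_of_consecutive[of _ q] shaded_column_consecutive[OF bij occ]) auto
  \<comment> \<open>Index 1 of the values belongs to the final letter, so the run occupies indices 2
    to \<open>q + 1\<close>.\<close>
  have V: "?V ! (2 + j) = ?V ! 2 + j" if "j \<le> q - 1" for j
    using that
    by (intro nth_add_of_consecutive[of _ "q - 1"] shaded_row_consecutive[OF bij occ]) auto
  define p where "p = is ! 0 - 1"
  have "is ! 0 \<in> {1..n}"
    using sub len by (metis nth_mem subsetD zero_less_Suc Suc_eq_plus1)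
  then have is0: "is ! 0 = p + 1"
    unfolding p_def by auto
  have isj: "is ! j = p + 1 + j" if "j \<le> q" for j
    using P[of j] that is0 len q by (simp add: nth_append)
  have "is ! q \<in> {1..n}"
    using sub len by (metis nth_mem subsetD less_add_one)
  then have pq: "p + q < n"
    using isj[of q] by simp
  have is_eq: "is = [p+1..<p+q+2]"
    using len isj by (intro nth_equalityI) (auto simp del: upt_Suc)
  then have is_snoc: "is = [p+1..<p+q+1] @ [p+q+1]"
    by simp
  have asc: "\<sigma> (p + 1 + j) < \<sigma> (p + 1 + k)" if "j < k" "k < q" for j k
    using ord[of j k] that isj[of j] isj[of k] by (simp add: nth_append del: upt_Suc)
  have low: "\<sigma> (p + q + 1) < \<sigma> (p + 1 + k)" if "k < q" for k
    using ord[of q k] that isj[of q] isj[of k] by (simp add: nth_append del: upt_Suc)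
  have "sorted (\<sigma> (p + q + 1) # map \<sigma> [p+1..<p+q+1])"
  proof -
    have "sorted (map \<sigma> [p+1..<p+q+1])"
      using asc by (auto simp: sorted_wrt_iff_nth_less simp del: upt_Suc intro!: less_imp_le)
    moreover have "\<sigma> (p + q + 1) \<le> \<sigma> x" if "x \<in> {p+1..<p+q+1}" for x
    proof -
      have "x - p - 1 < q" using that by auto
      then show ?thesis
        using low[of "x - p - 1"] that by auto
    qed
    ultimately show ?thesis
      by (auto simp del: upt_Suc)
  qed
  then have "sort (map \<sigma> is) = \<sigma> (p + q + 1) # map \<sigma> [p+1..<p+q+1]"
    unfolding is_snoc map_append list.map by (rule sort_snoc_min)
  then have nthV: "?V ! (2 + j) = \<sigma> (p + 1 + j)" if "j < q" for j
    using that by (simp add: nth_append del: upt_Suc)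
  have run: "\<sigma> (p + 1 + j) = \<sigma> (p + 1) + j" if "j < q" for j
    using that nthV[OF that] nthV[of 0] V[of j] q by auto
  have before: "\<sigma> (p + 1) < \<sigma> x" if x: "x \<in> {1..p}" for x
  proof (rule ccontr)
    assume "\<not> \<sigma> (p + 1) < \<sigma> x"
    moreover have notin: "\<sigma> x \<notin> \<sigma> ` set is"
    proof
      assume "\<sigma> x \<in> \<sigma> ` set is"
      then obtain z where "z \<in> set is" "\<sigma> x = \<sigma> z" by blast
      moreover have "z \<in> {1..n}" "x \<in> {1..n}"
        using sub x pq \<open>z \<in> set is\<close> by auto
      ultimately have "x = z"
        using bij by (metis bij_betw_imp_inj_on inj_onD)
      then show False
        using \<open>z \<in> set is\<close> x unfolding is_eq by auto
    qed
    moreover have "p + 1 \<in> set is"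
      unfolding is_eq using q by auto
    ultimately have lt: "\<sigma> x < \<sigma> (p + 1)"
      by (metis image_eqI linorder_neqE_nat)
    have yn: "\<sigma> x \<in> {1..n}"
      using bij x pq by (auto dest!: bij_betwE)
    then have "\<sigma> x \<notin> set ?V"
      using notin unfolding set_mesh_values by auto
    then obtain b where b: "Suc b < length ?V" "?V ! b < \<sigma> x" "\<sigma> x < ?V ! Suc b"
      using nth_between[of ?V "\<sigma> x"] yn by auto
    have "b \<le> q"
    proof (rule ccontr)
      assume "\<not> b \<le> q"
      then have "?V ! 2 \<le> ?V ! b"
        using sorted_wrt_nth_less[OF sorted_mesh_values[OF bij srt sub], of 2 b] b(1) q
        by (cases "b = 2") auto
      then show False
        using nthV[of 0] q lt b(2) by auto
    qed
    then have "(0, b) \<in> ?R" by auto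
    moreover have "?P ! 0 < x" "x < ?P ! Suc 0"
      using x is0 len by (auto simp: nth_append)
    ultimately show False
      using occ b(2,3) unfolding mesh_occurrence_iff by blast
  qed
  have "run_before q n \<sigma> p"
    using run before low[of 0] q pq unfolding run_before_def by auto
  then show "is \<in> (\<lambda>p. [p+1..<p+q+2]) ` {p. run_before q n \<sigma> p \<and> p + q < n}"
    using is_eq pq by blast
next
  let ?R = "{0} \<times> {0..q} \<union> {1..q} \<times> {0..q+1} \<union> {q+1} \<times> {2..q}"
  fix "is" assume "is \<in> (\<lambda>p. [p+1..<p+q+2]) ` {p. run_before q n \<sigma> p \<and> p + q < n}"
  then obtain p where is_eq: "is = [p+1..<p+q+2]" and rb: "run_before q n \<sigma> p" and pq: "p + q < n"
    by blast
  define i where "i = \<sigma> (p + 1)"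
  have run: "\<sigma> (p + 1 + j) = i + j" if "j < q" for j
    using rb that unfolding run_before_def i_def by blast
  have before: "i < \<sigma> x" if "x \<in> {1..p}" for x
    using rb that unfolding run_before_def i_def by blast
  have low: "\<sigma> (p + q + 1) < i"
    using rb pq unfolding run_before_def i_def by blast
  have "map \<sigma> [p+1..<p+q+1] = [i..<i+q]"
    using run by (intro nth_equalityI) (auto simp del: upt_Suc)
  then have "map \<sigma> is = [i..<i+q] @ [\<sigma> (p + q + 1)]"
    by (simp add: is_eq)
  then have "sort (map \<sigma> is) = \<sigma> (p + q + 1) # [i..<i+q]"
    using low by (simp only:) (rule sort_snoc_min, auto)
  then have V: "mesh_values n \<sigma> is = 0 # \<sigma> (p + q + 1) # [i..<i+q] @ [n + 1]"
    by simp
  have nthV: "mesh_values n \<sigma> is ! (2 + j) = i + j" if "j < q" for j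
    using that unfolding V by (simp add: nth_append)
  have nthP: "mesh_positions n is ! a = p + a" if "1 \<le> a" "a \<le> q + 1" for a
    using that by (cases a) (auto simp: is_eq nth_append simp del: upt_Suc)
  have isj: "is ! j = p + 1 + j" if "j \<le> q" for j
    using that unfolding is_eq by (simp del: upt_Suc)
  have "mesh_occurrence ([2..<q+2] @ [1], ?R) n \<sigma> is"
    unfolding mesh_occurrence_iff
  proof (intro conjI allI impI)
    fix a b
    assume "a < length ([2..<q+2] @ [1])" "b < length ([2..<q+2] @ [1])"
    then have ab: "a \<le> q" "b \<le> q"
      by (auto simp del: upt_Suc)
    have \<sigma>_is: "\<sigma> (is ! j) = (if j < q then i + j else \<sigma> (p + q + 1))" if "j \<le> q" for j
      using that isj[OF that] run[of j] by (auto simp: le_less)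
    have \<tau>: "([2..<q+2] @ [1]) ! j = (if j < q then 2 + j else 1)" if "j \<le> q" for j
      using that by (auto simp: nth_append le_less simp del: upt_Suc)
    show "\<sigma> (is ! a) < \<sigma> (is ! b) \<longleftrightarrow> ([2..<q+2] @ [1]) ! a < ([2..<q+2] @ [1]) ! b"
      using low unfolding \<sigma>_is[OF ab(1)] \<sigma>_is[OF ab(2)] \<tau>[OF ab(1)] \<tau>[OF ab(2)] by auto
  next
    fix a b x
    assume ab: "(a, b) \<in> ?R"
      and x: "mesh_positions n is ! a < x" "x < mesh_positions n is ! Suc a"
      and y: "mesh_values n \<sigma> is ! b < \<sigma> x" "\<sigma> x < mesh_values n \<sigma> is ! Suc b"
    \<comment> \<open>Besides the full columns and full rows, only the boxes (0,0) and (0,1) remain;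
      both lie below height \<open>i\<close>, while earlier letters lie above it.\<close>
    consider "1 \<le> a" "a \<le> q" | "2 \<le> b" "b \<le> q" | "a = 0" "b = 0 \<or> b = 1"
      using ab by fastforce
    then show False
    proof cases
      case 1
      then show ?thesis using x nthP[of a] nthP[of "Suc a"] by auto
    next
      case 2
      then obtain k where "b = 2 + k"
        by (metis le_Suc_ex)
      then show ?thesis
        using 2(2) y nthV[of k] nthV[of "Suc k"] by simp
    next
      case 3
      then have "x \<in> {1..p}"
        using x nthP[of 1] by auto
      moreover have "mesh_values n \<sigma> is ! Suc b \<le> i"
        using 3(2) low q unfolding V by (auto simp: nth_append)
      ultimately show ?thesis
        using before y(2) by force
    qed
  qed (use pq in \<open>auto simp: is_eq simp del: upt_Suc\<close>)
  then show "is \<in> mesh_occurrences (pattern_s q) n \<sigma>"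
    by (simp add: mesh_occurrences_def pattern_s_def del: upt_Suc)
qed

section \<open>Counting the runs\<close>

lemma inj_on_upt_shift:
  fixes f :: "'a \<Rightarrow> nat"
  assumes "k \<ge> 1" and "inj_on f A"
  shows "inj_on (\<lambda>p. [f p..<f p + k]) A"
proof -
  have "hd [f p..<f p + k] = f p" for p
    using assms(1) by simp
  then show ?thesis
    using assms(2) unfolding inj_on_def by metis
qed

theorem theorem1:
  fixes q n :: nat and \<pi> \<sigma> :: "nat \<Rightarrow> nat"
  assumes "q \<ge> 1"
    and "\<pi> permutes {1..n}"
    and "\<sigma> = foata n \<pi>"
  shows "card (adjacent_cycles q n \<pi>) =
         card (mesh_occurrences (pattern_r q) n \<sigma>) + card (mesh_occurrences (pattern_s q) n \<sigma>)"
proof -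
  let ?A = "{p. run_before q n \<sigma> p}"
  let ?Ar = "{p. run_before q n \<sigma> p \<and> p + q = n}" and ?As = "{p. run_before q n \<sigma> p \<and> p + q < n}"
  have bij: "bij_betw \<sigma> {1..n} {1..n}"
    using bij_betw_foata[OF assms(2)] assms(3) by simp
  \<comment> \<open>As \<open>q \<ge> 1\<close>, the position \<open>p + 1\<close> lies in
    \<open>{1..n}\<close>, where \<open>\<sigma>\<close> is injective; so different runs give
    different cycles.\<close>
  have "inj_on (\<lambda>p. \<sigma> (p + 1)) ?A"
  proof (rule inj_onI)
    fix p p' assume "p \<in> ?A" "p' \<in> ?A" "\<sigma> (p + 1) = \<sigma> (p' + 1)"
    moreover from this have "p + 1 \<in> {1..n}" "p' + 1 \<in> {1..n}"
      using assms(1) by (auto simp: run_before_def)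
    ultimately show "p = p'"
      using bij by (metis add_right_cancel bij_betw_imp_inj_on inj_onD)
  qed
  then have "card (adjacent_cycles q n \<pi>) = card ?A"
    using assms(1) unfolding adjacent_cycles_eq_runs[OF assms]
    by (intro card_image) (rule inj_on_upt_shift)
  \<comment> \<open>A run ends at the last position or before it; the first kind gives the
    occurrences of \<open>pattern_r q\<close>, the second those of
    \<open>pattern_s q\<close>.\<close>
  also have "?A = ?Ar \<union> ?As"
    by (auto simp: run_before_def)
  also have "card (?Ar \<union> ?As) = card ?Ar + card ?As"
    by (rule card_Un_disjoint) (auto intro: finite_subset[of _ "{..n}"])
  also have "card ?Ar = card (mesh_occurrences (pattern_r q) n \<sigma>)"
    unfolding mesh_occurrences_r[OF bij assms(1)]
    using inj_on_upt_shift[OF assms(1), of "\<lambda>p. p + 1" ?Ar]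
    by (intro card_image[symmetric]) (simp add: ac_simps del: upt_Suc)
  also have "card ?As = card (mesh_occurrences (pattern_s q) n \<sigma>)"
    unfolding mesh_occurrences_s[OF bij assms(1)]
    using inj_on_upt_shift[of "q + 1" "\<lambda>p. p + 1" ?As]
    by (intro card_image[symmetric]) (simp add: ac_simps del: upt_Suc)
  finally show ?thesis .
qed

end
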